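(* Let $n\ge 1$ be an integer, let $I\subset[0,\infty)$ be an interval, and let $f:I\to\mathbb{R}$ be an $n$-times differentiable function on $I^\circ$ such that $f^{(n)}\in L^1[a,b]$, where $a,b\in I$, $a<b$. Let $p,q$ be conjugate numbers where $q\ge 1$ and $p=\frac{q}{q-1}$. If $|f^{(n)}|^q$ is $s$-convex (in the second sense) on $[a,b]$ for some fixed $s\in(0,1]$, then $$\left|\sum_{m=1}^n(-1)^{n-m+2}\frac{(b-a)^m}{2\cdot(m!)}\left[f^{(m-1)}(b)-(-1)^m f^{(m-1)}(a)\right]+(-1)^n\int_a^b f(x)\,dx\right|$$ $$\le\frac{(b-a)^{n+1}}{n!}\left(\frac{1}{np+1}\right)^{\frac1p}(s+1)^{-\frac1q}\left(|f^{(n)}(a)|^q+|f^{(n)}(b)|^q\right)^{\frac1q}$$ $$=\frac{(b-a)^{n+1}}{n!}\left(\beta(np+1,1)\right)^{\frac1p}(s+1)^{-\frac1q}\left(|f^{(n)}(a)|^q+|f^{(n)}(b)|^q\right)^{\frac1q}.$$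
   Context: $I^\circ$ denotes the interior of $I$. A real function $g$ on $[a,b]\subset[0,\infty)$ is $s$-convex (in the second sense), $s\in(0,1]$, if $g(tx+(1-t)y)\le t^s g(x)+(1-t)^s g(y)$ for all $x,y\in[a,b]$ and $t\in[0,1]$. The Beta function is $\beta(x,y)=\int_0^1 t^{x-1}(1-t)^{y-1}\,dt$ for $x,y>0$. It is understood that $f$ is $n$ times differentiable at every point of $[a,b]$ (one-sided at a point that is an endpoint of $I$), so that $f^{(n)}$ is defined on all of $[a,b]$; $f^{(0)}=f$. When $q=1$ (so $p=\infty$), the factors $(1/(np+1))^{1/p}$ and $(\beta(np+1,1))^{1/p}$ are read as their limit $1$. *)

theory Defs
  imports "HOL-Analysis.Analysis"
begin

text \<open>
  Derivatives are taken within \<^term>\<open>S\<close>: two-sided at interior points of \<^term>\<open>S\<close>, one-sided at an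
  endpoint of an interval \<^term>\<open>S\<close>. At a point where the derivative does not exist the value is
  unspecified.
\<close>

primrec nderiv :: "real set \<Rightarrow> nat \<Rightarrow> (real \<Rightarrow> real) \<Rightarrow> real \<Rightarrow> real" where
  "nderiv S 0 f = f"
| "nderiv S (Suc k) f = (\<lambda>x. vector_derivative (nderiv S k f) (at x within S))"

definition n_times_differentiable_on ::
    "real set \<Rightarrow> nat \<Rightarrow> (real \<Rightarrow> real) \<Rightarrow> real set \<Rightarrow> bool" where
  "n_times_differentiable_on S n f A \<longleftrightarrow>
     (\<forall>k<n. \<forall>x\<in>A. nderiv S k f differentiable (at x within S))"

lemma n_times_differentiable_on_has_real_derivative:
  assumes "n_times_differentiable_on S n f A" "k < n" "x \<in> A"
  shows "(nderiv S k f has_real_derivative nderiv S (Suc k) f x) (at x within S)"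
  using assms
  by (simp add: n_times_differentiable_on_def has_real_derivative_iff_has_vector_derivative
      vector_derivative_works[symmetric])

text \<open>\<^term>\<open>s\<close>-convexity in the second sense.\<close>

definition s_convex_on :: "real \<Rightarrow> real set \<Rightarrow> (real \<Rightarrow> real) \<Rightarrow> bool" where
  "s_convex_on s S g \<longleftrightarrow>
     (\<forall>x\<in>S. \<forall>y\<in>S. \<forall>t\<in>{0..1}.
        g (t * x + (1 - t) * y) \<le> t powr s * g x + (1 - t) powr s * g y)"

text \<open>
  The library defines \<^const>\<open>Beta\<close> through \<^const>\<open>Gamma\<close>; for positive arguments it is the Euler integral.
\<close>

lemma Beta_eq_integral:
  fixes x y :: real
  assumes "x > 0" "y > 0"
  shows "Beta x y = integral {0..1} (\<lambda>t. t powr (x - 1) * (1 - t) powr (y - 1))"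
  using has_integral_Beta_real[OF assms] by (simp add: integral_unique)

end

theory Submission
  imports Defs
begin

text \<open>
  The left-hand side is the average of two Taylor remainders. Repeated integration by parts of
  \<open>(x - c)\<^sup>n / n!\<close> against \<open>f\<^sup>(\<^sup>n\<^sup>)\<close> over \<open>[a, b]\<close> removes the derivatives one at a time and ends
  with \<open>(-1)\<^sup>n\<close> times the integral of \<open>f\<close>. The boundary terms vanish at \<open>c\<close>, so the kernel
  centred at \<open>a\<close> leaves only values at \<open>b\<close> and the one centred at \<open>b\<close> only values at \<open>a\<close>; half
  their sum is exactly the quantity to be estimated (\<open>trapezoid_sum_eq_taylor_kernels\<close>).
  All \<open>n\<close> integrations by parts are carried out at once, by exhibiting an antiderivative in closed
  form. Since it is differentiable at every point of \<open>[a, b]\<close>, the fundamental theorem for the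
  Henstock--Kurzweil integral applies although \<open>f\<^sup>(\<^sup>n\<^sup>)\<close> may be discontinuous.

  Each of the two integrals satisfies the claimed bound separately
  (\<open>taylor_kernel_bound_s_convex\<close>). By \<open>s\<close>-convexity \<open>|f\<^sup>(\<^sup>n\<^sup>)|\<^sup>q\<close> lies below the function
  \<open>t\<^sup>s |f\<^sup>(\<^sup>n\<^sup>)(b)|\<^sup>q + (1 - t)\<^sup>s |f\<^sup>(\<^sup>n\<^sup>)(a)|\<^sup>q\<close> of \<open>t = (x - a) / (b - a)\<close>, which integrates to
  \<open>b - a\<close> times the sum of the two end values over \<open>s + 1\<close>. Hoelder's inequality separates this
  majorant from the kernel, whose \<open>p\<close>-norm produces the factor \<open>1 / (n p + 1)\<close>; when \<open>q = 1\<close> the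
  kernel is replaced by its maximum. Only the explicit majorants are ever integrated, so the
  measurability of powers of \<open>|f\<^sup>(\<^sup>n\<^sup>)|\<close> does not arise.
\<close>

section \<open>Integrals of powers of the distance to an endpoint\<close>

lemma has_integral_powr_left_endpoint:
  fixes a b r :: real
  assumes "a \<le> b" "r > -1"
  shows "((\<lambda>x. (x - a) powr r) has_integral (b - a) powr (r + 1) / (r + 1)) {a..b}"
proof -
  have "((\<lambda>x. (x - a) powr r) has_integral
      (b - a) powr (r + 1) / (r + 1) - (a - a) powr (r + 1) / (r + 1)) {a..b}"
  proof (rule fundamental_theorem_of_calculus_interior[OF assms(1)])
    show "continuous_on {a..b} (\<lambda>x. (x - a) powr (r + 1) / (r + 1))"
      using assms by (intro continuous_on_powr' continuous_intros) auto
    fix x assume "x \<in> {a<..<b}"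
    then have "((\<lambda>x. (x - a) powr (r + 1)) has_real_derivative (r + 1) * (x - a) powr (r + 1 - of_nat 1) * 1)
        (at x)"
      by (intro DERIV_fun_powr) (auto intro!: derivative_eq_intros)
    from DERIV_cdivide[OF this, of "r + 1"]
    show "((\<lambda>x. (x - a) powr (r + 1) / (r + 1)) has_vector_derivative (x - a) powr r) (at x)"
      using assms by (simp add: has_real_derivative_iff_has_vector_derivative)
  qed
  then show ?thesis by simp
qed

lemma has_integral_powr_right_endpoint:
  fixes a b r :: real
  assumes "a \<le> b" "r > -1"
  shows "((\<lambda>x. (b - x) powr r) has_integral (b - a) powr (r + 1) / (r + 1)) {a..b}"
  using has_integral_powr_left_endpoint[of "-b" "-a" r] assms
    has_integral_reflect_real[where f = "\<lambda>x. (x + b) powr r" and a = "-b" and b = "-a"]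
  by (simp add: add.commute)

lemma has_integral_abs_powr_endpoint:
  fixes a b c r :: real
  assumes "a \<le> b" "r > -1" "c \<in> {a, b}"
  shows "((\<lambda>x. \<bar>x - c\<bar> powr r) has_integral (b - a) powr (r + 1) / (r + 1)) {a..b}"
proof (cases "c = a")
  case True
  then show ?thesis
    by (intro has_integral_eq[OF _ has_integral_powr_left_endpoint]) (use assms in auto)
next
  case False
  then have "c = b" using assms by simp
  then show ?thesis
    by (intro has_integral_eq[OF _ has_integral_powr_right_endpoint]) (use assms in auto)
qed

section \<open>Hoelder's inequality through majorants\<close>

text \<open>
  Young's inequality for \<open>U / K\<close> and \<open>V / L\<close> gives a pointwise bound of \<open>h\<close> that is linear in
  \<open>U\<close> and \<open>V\<close>, and the weights \<open>\<alpha>\<close>, \<open>\<beta>\<close> are chosen so that its integral is the product on the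
  right. The functions \<open>U\<close> and \<open>V\<close> may be any majorants of the \<open>1/\<alpha>\<close>-th and \<open>1/\<beta>\<close>-th powers of two
  factors of \<open>h\<close>; this allows an irregular factor to be replaced by an explicit function.
\<close>

lemma Hoelder_integral_majorant:
  fixes U V h :: "'a::euclidean_space \<Rightarrow> real" and \<alpha> \<beta> :: real
  assumes \<alpha>\<beta>: "\<alpha> > 0" "\<beta> > 0" "\<alpha> + \<beta> = 1"
    and U: "(U has_integral K) S" "\<And>x. x \<in> S \<Longrightarrow> 0 \<le> U x"
    and V: "(V has_integral L) S" "\<And>x. x \<in> S \<Longrightarrow> 0 \<le> V x"
    and h: "h integrable_on S" "\<And>x. x \<in> S \<Longrightarrow> \<bar>h x\<bar> \<le> U x powr \<alpha> * V x powr \<beta>"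
  shows "\<bar>integral S h\<bar> \<le> K powr \<alpha> * L powr \<beta>"
proof -
  have K0: "K \<ge> 0" and L0: "L \<ge> 0"
    using has_integral_nonneg[OF U] has_integral_nonneg[OF V] by auto
  \<comment> \<open>\<^term>\<open>K\<close> or \<^term>\<open>L\<close> may vanish, so the normalisation uses \<open>K + e\<close> and \<open>L + e\<close>, and \<open>e\<close> tends to \<open>0\<close>.\<close>
  have perturbed: "\<bar>integral S h\<bar> \<le> (K + e) powr \<alpha> * (L + e) powr \<beta>" if e: "e > 0" for e
  proof -
    let ?K = "K + e" and ?L = "L + e"
    let ?C = "?K powr \<alpha> * ?L powr \<beta>"
    have pos: "?K > 0" "?L > 0" using K0 L0 e by auto
    have pointwise: "\<bar>h x\<bar> \<le> ?C * (\<alpha> * (U x / ?K) + \<beta> * (V x / ?L))" if x: "x \<in> S" for x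
    proof -
      have "(U x / ?K) powr \<alpha> * (V x / ?L) powr \<beta> \<le> \<alpha> * (U x / ?K) + \<beta> * (V x / ?L)"
      proof (cases "U x = 0 \<or> V x = 0")
        case True
        then show ?thesis using pos \<alpha>\<beta> U(2)[OF x] V(2)[OF x] by auto
      next
        case False
        then show ?thesis
          using pos \<alpha>\<beta> U(2)[OF x] V(2)[OF x] by (intro Youngs_inequality_0) auto
      qed
      then have "?C * ((U x / ?K) powr \<alpha> * (V x / ?L) powr \<beta>)
          \<le> ?C * (\<alpha> * (U x / ?K) + \<beta> * (V x / ?L))"
        using pos by (intro mult_left_mono) auto
      moreover have "?C * ((U x / ?K) powr \<alpha> * (V x / ?L) powr \<beta>) = U x powr \<alpha> * V x powr \<beta>"
        using pos U(2)[OF x] V(2)[OF x] by (simp add: powr_divide)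
      ultimately show ?thesis using h(2)[OF x] by linarith
    qed
    have "((\<lambda>x. ?C * (\<alpha> * (U x / ?K) + \<beta> * (V x / ?L)))
        has_integral ?C * (\<alpha> * (K / ?K) + \<beta> * (L / ?L))) S"
      by (intro has_integral_mult_right has_integral_add has_integral_divide U(1) V(1))
    then have "norm (integral S h) \<le> ?C * (\<alpha> * (K / ?K) + \<beta> * (L / ?L))"
      using integral_norm_bound_integral[OF h(1), of "\<lambda>x. ?C * (\<alpha> * (U x / ?K) + \<beta> * (V x / ?L))"]
        pointwise by (auto simp: has_integral_iff)
    also have "\<dots> \<le> ?C * (\<alpha> * 1 + \<beta> * 1)"
      using pos e \<alpha>\<beta> by (intro mult_left_mono add_mono) auto
    finally show ?thesis using \<alpha>\<beta> by simp
  qed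
  have ev: "eventually (\<lambda>e::real. e > 0) (at_right 0)" by (rule eventually_at_right_less)
  have "((\<lambda>e. (K + e) powr \<alpha> * (L + e) powr \<beta>) \<longlongrightarrow> (K + 0) powr \<alpha> * (L + 0) powr \<beta>) (at_right 0)"
    using \<alpha>\<beta> K0 L0 by (intro tendsto_intros disjI2 conjI eventually_mono[OF ev]) auto
  moreover have "\<forall>\<^sub>F e in at_right 0. \<bar>integral S h\<bar> \<le> (K + e) powr \<alpha> * (L + e) powr \<beta>"
    by (rule eventually_mono[OF ev perturbed])
  ultimately have "\<bar>integral S h\<bar> \<le> (K + 0) powr \<alpha> * (L + 0) powr \<beta>"
    by (rule tendsto_lowerbound) simp
  then show ?thesis by simp
qed

section \<open>The majorant supplied by \<open>s\<close>-convexity\<close>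

lemma s_convex_on_le_chord:
  assumes "s_convex_on s {a..b} g" "a < b" "x \<in> {a..b}"
  shows "g x \<le> ((x - a) powr s * g b + (b - x) powr s * g a) / (b - a) powr s"
proof -
  define t where "t = (x - a) / (b - a)"
  have t: "t \<in> {0..1}" "1 - t = (b - x) / (b - a)" "t * b + (1 - t) * a = x"
  proof -
    have "t * (b - a) = x - a" using assms by (simp add: t_def)
    then show "t * b + (1 - t) * a = x" by (simp add: algebra_simps)
  qed (use assms in \<open>auto simp: t_def field_simps\<close>)
  have "g (t * b + (1 - t) * a) \<le> t powr s * g b + (1 - t) powr s * g a"
    using assms t(1) unfolding s_convex_on_def by (metis atLeastAtMost_iff less_imp_le order_refl)
  then show ?thesis
    unfolding t(3) unfolding t(2) using assms by (simp add: t_def powr_divide add_divide_distrib)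
qed

lemma has_integral_s_convex_chord:
  fixes a b s A B :: real
  assumes "a < b" "0 < s"
  shows "((\<lambda>x. ((x - a) powr s * B + (b - x) powr s * A) / (b - a) powr s)
      has_integral (b - a) * (A + B) / (s + 1)) {a..b}"
proof -
  let ?J = "(b - a) powr (s + 1) / (s + 1)"
  have "((\<lambda>x. ((x - a) powr s * B + (b - x) powr s * A) / (b - a) powr s)
      has_integral (?J * B + ?J * A) / (b - a) powr s) {a..b}"
    using assms
    by (intro has_integral_divide has_integral_add has_integral_mult_left
        has_integral_powr_left_endpoint has_integral_powr_right_endpoint) auto
  moreover have "(?J * B + ?J * A) / (b - a) powr s = (b - a) * (A + B) / (s + 1)"
    using assms by (simp add: powr_add divide_simps) (simp add: algebra_simps)
  ultimately show ?thesis by simp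
qed

section \<open>Repeated integration by parts\<close>

text \<open>
  The family \<open>d\<close> stands for the successive derivatives of \<open>d 0\<close>. The sum collects the boundary terms
  of \<open>n\<close> integrations by parts of \<open>(x - c)\<^sup>n / n! * d n x\<close>.
\<close>

definition taylor_antiderivative :: "(nat \<Rightarrow> real \<Rightarrow> real) \<Rightarrow> real \<Rightarrow> nat \<Rightarrow> real \<Rightarrow> real" where
  "taylor_antiderivative d c n x =
     (\<Sum>m=1..n. (-1) ^ (n - m) * ((x - c) ^ m / fact m) * d (m - 1) x)"

lemma taylor_antiderivative_Suc:
  "taylor_antiderivative d c (Suc n) x =
     (x - c) ^ Suc n / fact (Suc n) * d n x - taylor_antiderivative d c n x"
proof -
  have "(\<Sum>m=1..n. (-1) ^ (Suc n - m) * ((x - c) ^ m / fact m) * d (m - 1) x)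
      = - taylor_antiderivative d c n x"
    unfolding taylor_antiderivative_def sum_negf[symmetric]
    by (intro sum.cong) (auto simp: Suc_diff_le)
  then show ?thesis by (simp add: taylor_antiderivative_def)
qed

text \<open>
  The derivative telescopes: differentiating \<open>(x - c)\<^sup>n\<^sup>+\<^sup>1 / (n+1)! * d n x\<close> gives the kernel of order
  \<open>n + 1\<close> and the kernel of order \<open>n\<close>, and the recursion subtracts the latter.
\<close>

lemma has_real_derivative_taylor_antiderivative:
  assumes "\<And>k. k < n \<Longrightarrow> (d k has_real_derivative d (Suc k) x) (at x within S)"
  shows "(taylor_antiderivative d c n has_real_derivative
      (x - c) ^ n / fact n * d n x - (-1) ^ n * d 0 x) (at x within S)"
  using assms
proof (induction n)
  case 0
  then show ?case by (simp add: taylor_antiderivative_def[abs_def])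
next
  case (Suc n)
  have IH: "(taylor_antiderivative d c n has_real_derivative
      (x - c) ^ n / fact n * d n x - (-1) ^ n * d 0 x) (at x within S)"
    using Suc by simp
  have dn: "(d n has_real_derivative d (Suc n) x) (at x within S)"
    using Suc.prems by simp
  have pw: "((\<lambda>x. (x - c) ^ Suc n / fact (Suc n)) has_real_derivative (x - c) ^ n / fact n)
      (at x within S)"
    by (rule derivative_eq_intros refl | simp)+
  have "((\<lambda>x. (x - c) ^ Suc n / fact (Suc n) * d n x - taylor_antiderivative d c n x)
      has_real_derivative ((x - c) ^ n / fact n * d n x + d (Suc n) x * ((x - c) ^ Suc n / fact (Suc n)))
        - ((x - c) ^ n / fact n * d n x - (-1) ^ n * d 0 x)) (at x within S)"
    by (intro DERIV_diff DERIV_mult IH dn pw)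
  then show ?case
    unfolding taylor_antiderivative_Suc[abs_def]
    by (rule DERIV_cong) (simp add: mult.commute)
qed

lemma has_integral_taylor_kernel:
  assumes "a \<le> b" "n \<ge> 1"
    and d: "\<And>k x. k < n \<Longrightarrow> x \<in> {a..b} \<Longrightarrow>
      (d k has_real_derivative d (Suc k) x) (at x within {a..b})"
  shows "((\<lambda>x. (x - c) ^ n / fact n * d n x) has_integral
      taylor_antiderivative d c n b - taylor_antiderivative d c n a
        + (-1) ^ n * integral {a..b} (d 0)) {a..b}"
proof -
  have "((\<lambda>x. (x - c) ^ n / fact n * d n x - (-1) ^ n * d 0 x) has_integral
      taylor_antiderivative d c n b - taylor_antiderivative d c n a) {a..b}"
    using assms has_real_derivative_taylor_antiderivative[of n d]
    by (intro fundamental_theorem_of_calculus)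
      (auto simp: has_real_derivative_iff_has_vector_derivative[symmetric])
  moreover have "((\<lambda>x. (-1) ^ n * d 0 x) has_integral (-1) ^ n * integral {a..b} (d 0)) {a..b}"
  proof -
    have "continuous_on {a..b} (d 0)"
      using d[of 0] assms(2) by (intro DERIV_continuous_on) auto
    then show ?thesis
      by (intro has_integral_mult_right integrable_integral integrable_continuous_real)
  qed
  ultimately show ?thesis
    by (rule has_integral_eq[OF _ has_integral_add, rotated]) simp
qed

text \<open>
  The boundary terms of a kernel vanish at its centre, so the two kernels account for the values at
  \<open>b\<close> and at \<open>a\<close> respectively; the sign \<open>(-1)\<^sup>m\<close> is that of \<open>(a - b)\<^sup>m\<close>.
\<close>

lemma trapezoid_sum_eq_taylor_kernels:
  fixes d :: "nat \<Rightarrow> real \<Rightarrow> real"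
  assumes "a \<le> b" "n \<ge> 1"
    and "\<And>k x. k < n \<Longrightarrow> x \<in> {a..b} \<Longrightarrow>
      (d k has_real_derivative d (Suc k) x) (at x within {a..b})"
  shows "(\<Sum>m=1..n. (-1) ^ (n - m + 2) * ((b - a) ^ m / (2 * fact m))
              * (d (m - 1) b - (-1) ^ m * d (m - 1) a)) + (-1) ^ n * integral {a..b} (d 0)
    = (integral {a..b} (\<lambda>x. (x - a) ^ n / fact n * d n x)
       + integral {a..b} (\<lambda>x. (x - b) ^ n / fact n * d n x)) / 2"
proof -
  have at_centre: "taylor_antiderivative d c n c = 0" for c
    unfolding taylor_antiderivative_def by (intro sum.neutral) auto
  have flip: "(a - b) ^ m = (-1) ^ m * (b - a) ^ m" for m
    by (metis minus_diff_eq mult_minus1 power_mult_distrib)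
  have sum_eq: "(\<Sum>m=1..n. (-1) ^ (n - m + 2) * ((b - a) ^ m / (2 * fact m))
              * (d (m - 1) b - (-1) ^ m * d (m - 1) a))
      = (taylor_antiderivative d a n b - taylor_antiderivative d b n a) / 2"
    unfolding taylor_antiderivative_def sum_subtractf[symmetric] sum_divide_distrib flip
    by (intro sum.cong) (auto simp: field_simps)
  have kernel_eq: "integral {a..b} (\<lambda>x. (x - c) ^ n / fact n * d n x)
      = taylor_antiderivative d c n b - taylor_antiderivative d c n a
        + (-1) ^ n * integral {a..b} (d 0)" for c
    using has_integral_taylor_kernel[where d = d and c = c, OF assms] by (rule integral_unique)
  show ?thesis
    unfolding sum_eq kernel_eq by (simp add: at_centre field_simps)
qed

section \<open>The estimate of one Taylor kernel\<close>

text \<open>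
  The bound is symmetric in the end values of \<open>g\<close> and depends on the kernel only through its norm,
  which is the same for the centres \<open>a\<close> and \<open>b\<close>.
\<close>

lemma taylor_kernel_bound_s_convex:
  fixes g :: "real \<Rightarrow> real" and a b c p q s :: real
  assumes "n \<ge> 1" "a < b" "c \<in> {a, b}" "0 < s"
    and q: "q \<ge> 1" "q \<noteq> 1 \<Longrightarrow> p = q / (q - 1)"
    and convex: "s_convex_on s {a..b} (\<lambda>x. \<bar>g x\<bar> powr q)"
    and int: "(\<lambda>x. (x - c) ^ n / fact n * g x) integrable_on {a..b}"
  shows "\<bar>integral {a..b} (\<lambda>x. (x - c) ^ n / fact n * g x)\<bar>
      \<le> (b - a) ^ (n + 1) / fact n
          * (if q = 1 then 1 else (1 / (real n * p + 1)) powr (1 / p))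
          * (s + 1) powr (- (1 / q))
          * (\<bar>g a\<bar> powr q + \<bar>g b\<bar> powr q) powr (1 / q)"
proof -
  define A B where "A = \<bar>g a\<bar> powr q" and "B = \<bar>g b\<bar> powr q"
  define \<phi> where "\<phi> = (\<lambda>x. ((x - a) powr s * B + (b - x) powr s * A) / (b - a) powr s)"
  have AB: "A \<ge> 0" "B \<ge> 0" by (auto simp: A_def B_def)
  have \<phi>_int: "(\<phi> has_integral (b - a) * (A + B) / (s + 1)) {a..b}"
    unfolding \<phi>_def by (rule has_integral_s_convex_chord) (use assms in auto)
  have g_le: "\<bar>g x\<bar> powr q \<le> \<phi> x" if "x \<in> {a..b}" for x
    using s_convex_on_le_chord[OF convex \<open>a < b\<close> that] by (simp add: \<phi>_def A_def B_def)
  have c_le: "\<bar>x - c\<bar> \<le> b - a" if "x \<in> {a..b}" for x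
    using that assms(3) by auto
  have abs_kernel: "\<bar>(x - c) ^ n / fact n * g x\<bar> = \<bar>x - c\<bar> ^ n / fact n * \<bar>g x\<bar>" for x
    by (simp add: abs_mult power_abs)
  show ?thesis
  proof (cases "q = 1")
    case True
    have "((\<lambda>x. (b - a) ^ n / fact n * \<phi> x) has_integral
        (b - a) ^ n / fact n * ((b - a) * (A + B) / (s + 1))) {a..b}"
      by (intro has_integral_mult_right \<phi>_int)
    moreover have "\<bar>(x - c) ^ n / fact n * g x\<bar> \<le> (b - a) ^ n / fact n * \<phi> x"
      if "x \<in> {a..b}" for x
      unfolding abs_kernel using g_le[OF that] c_le[OF that] True assms
      by (intro mult_mono divide_right_mono power_mono) auto
    ultimately have "\<bar>integral {a..b} (\<lambda>x. (x - c) ^ n / fact n * g x)\<bar>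
        \<le> (b - a) ^ n / fact n * ((b - a) * (A + B) / (s + 1))"
      using integral_norm_bound_integral[OF int, of "\<lambda>x. (b - a) ^ n / fact n * \<phi> x"]
      by (auto simp: has_integral_iff)
    also have "\<dots> = (b - a) ^ (n + 1) / fact n * 1 * (s + 1) powr (- (1 / q))
        * (A + B) powr (1 / q)"
      using True \<open>0 < s\<close> AB by (simp add: powr_minus divide_inverse)
    finally show ?thesis using True by (simp add: A_def B_def)
  next
    case False
    then have q1: "q > 1" and p: "p = q / (q - 1)" using q by auto
    have p1: "p > 1" and conj: "1 / p + 1 / q = 1"
      using q1 by (auto simp: p field_simps)
    define r where "r = real n * p"
    have r: "r > 0" using p1 assms by (simp add: r_def)
    \<comment> \<open>The \<^term>\<open>p\<close>-th power of the absolute value of the kernel.\<close>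
    define U where "U = (\<lambda>x. (1 / fact n) powr p * \<bar>x - c\<bar> powr r)"
    have U_int: "(U has_integral (1 / fact n) powr p * ((b - a) powr (r + 1) / (r + 1))) {a..b}"
      unfolding U_def
      by (intro has_integral_mult_right has_integral_abs_powr_endpoint) (use assms r in auto)
    have U_root: "U x powr (1 / p) = \<bar>x - c\<bar> ^ n / fact n" for x
      using p1 assms
      by (cases "x = c") (simp_all add: U_def r_def powr_mult powr_powr powr_realpow)
    have "\<bar>integral {a..b} (\<lambda>x. (x - c) ^ n / fact n * g x)\<bar>
        \<le> ((1 / fact n) powr p * ((b - a) powr (r + 1) / (r + 1))) powr (1 / p)
          * ((b - a) * (A + B) / (s + 1)) powr (1 / q)"
    proof (rule Hoelder_integral_majorant[OF _ _ conj U_int _ \<phi>_int _ int])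
      fix x assume x: "x \<in> {a..b}"
      show "0 \<le> U x" by (simp add: U_def)
      show "0 \<le> \<phi> x" using AB by (simp add: \<phi>_def)
      have "\<bar>g x\<bar> = (\<bar>g x\<bar> powr q) powr (1 / q)"
        using q1 by (simp add: powr_powr)
      also have "\<dots> \<le> \<phi> x powr (1 / q)"
        using g_le[OF x] q1 by (intro powr_mono2) auto
      finally show "\<bar>(x - c) ^ n / fact n * g x\<bar> \<le> U x powr (1 / p) * \<phi> x powr (1 / q)"
        unfolding abs_kernel U_root by (intro mult_left_mono) auto
    qed (use p1 q1 in auto)
    also have "((1 / fact n) powr p * ((b - a) powr (r + 1) / (r + 1))) powr (1 / p)
        = 1 / fact n * ((b - a) ^ n * (b - a) powr (1 / p)) * (1 / (r + 1)) powr (1 / p)"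
    proof -
      have "((b - a) powr (r + 1)) powr (1 / p) = (b - a) ^ n * (b - a) powr (1 / p)"
      proof -
        have "(r + 1) * (1 / p) = real n + 1 / p"
          using p1 by (simp add: r_def field_simps)
        then show ?thesis
          unfolding powr_powr using \<open>a < b\<close> by (simp add: powr_add powr_realpow)
      qed
      then show ?thesis
        using p1 r \<open>a < b\<close> by (simp add: powr_mult powr_divide powr_powr)
    qed
    also have "((b - a) * (A + B) / (s + 1)) powr (1 / q)
        = (b - a) powr (1 / q) * (A + B) powr (1 / q) * (s + 1) powr (- (1 / q))"
      using AB assms by (simp add: powr_mult powr_divide powr_minus_divide)
    also have "1 / fact n * ((b - a) ^ n * (b - a) powr (1 / p)) * (1 / (r + 1)) powr (1 / p)
          * ((b - a) powr (1 / q) * (A + B) powr (1 / q) * (s + 1) powr (- (1 / q)))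
        = (b - a) ^ n * ((b - a) powr (1 / p) * (b - a) powr (1 / q)) / fact n
          * (1 / (r + 1)) powr (1 / p) * (s + 1) powr (- (1 / q)) * (A + B) powr (1 / q)"
      by (simp add: mult_ac)
    also have "(b - a) powr (1 / p) * (b - a) powr (1 / q) = b - a"
      unfolding powr_add[symmetric] conj using \<open>a < b\<close> by simp
    finally show ?thesis
      using False by (simp add: A_def B_def r_def mult_ac)
  qed
qed

section \<open>The trapezoid inequality\<close>

lemma Beta_one_right:
  fixes x :: real
  assumes "x > 0"
  shows "Beta x 1 = 1 / x"
proof -
  have "x \<notin> \<int>\<^sub>\<le>\<^sub>0" using assms by (auto elim!: nonpos_Ints_cases)
  then show ?thesis
    unfolding Beta_def using Gamma_real_pos[OF assms] by (subst Gamma_plus1) auto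
qed

theorem theorem9:
  fixes n :: nat and I :: "real set" and f :: "real \<Rightarrow> real" and a b p q s :: real
  assumes "n \<ge> 1"
    and "is_interval I" and "I \<subseteq> {0..}"
    and "a \<in> I" and "b \<in> I" and "a < b"
    and "n_times_differentiable_on I n f (interior I)"
    and "n_times_differentiable_on I n f {a..b}"
    and "nderiv I n f absolutely_integrable_on {a..b}"
    and "q \<ge> 1" and "q \<noteq> 1 \<Longrightarrow> p = q / (q - 1)"
    and "0 < s" and "s \<le> 1"
    and "s_convex_on s {a..b} (\<lambda>x. \<bar>nderiv I n f x\<bar> powr q)"
  shows "\<bar>(\<Sum>m=1..n. (-1) ^ (n - m + 2) * ((b - a) ^ m / (2 * fact m))
              * (nderiv I (m - 1) f b - (-1) ^ m * nderiv I (m - 1) f a))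
            + (-1) ^ n * integral {a..b} f\<bar>
      \<le> (b - a) ^ (n + 1) / fact n
          * (if q = 1 then 1 else (1 / (real n * p + 1)) powr (1 / p))
          * (s + 1) powr (- (1 / q))
          * (\<bar>nderiv I n f a\<bar> powr q + \<bar>nderiv I n f b\<bar> powr q) powr (1 / q)
    \<and> (b - a) ^ (n + 1) / fact n
          * (if q = 1 then 1 else (1 / (real n * p + 1)) powr (1 / p))
          * (s + 1) powr (- (1 / q))
          * (\<bar>nderiv I n f a\<bar> powr q + \<bar>nderiv I n f b\<bar> powr q) powr (1 / q)
      = (b - a) ^ (n + 1) / fact n
          * (if q = 1 then 1 else (Beta (real n * p + 1) 1) powr (1 / p))
          * (s + 1) powr (- (1 / q))
          * (\<bar>nderiv I n f a\<bar> powr q + \<bar>nderiv I n f b\<bar> powr q) powr (1 / q)"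
proof -
  let ?d = "\<lambda>k. nderiv I k f"
  let ?C = "(b - a) ^ (n + 1) / fact n
          * (if q = 1 then 1 else (1 / (real n * p + 1)) powr (1 / p))
          * (s + 1) powr (- (1 / q))
          * (\<bar>?d n a\<bar> powr q + \<bar>?d n b\<bar> powr q) powr (1 / q)"
  have ab: "a \<le> b" using \<open>a < b\<close> by simp
  have "{a..b} \<subseteq> I"
    using mem_is_interval_1_I[OF \<open>is_interval I\<close> \<open>a \<in> I\<close> \<open>b \<in> I\<close>] by auto
  then have d: "(?d k has_real_derivative ?d (Suc k) x) (at x within {a..b})"
    if "k < n" "x \<in> {a..b}" for k x
    using n_times_differentiable_on_has_real_derivative[OF assms(8) that]
      has_field_derivative_subset by blast
  have bound: "\<bar>integral {a..b} (\<lambda>x. (x - c) ^ n / fact n * ?d n x)\<bar> \<le> ?C" if "c \<in> {a, b}" for c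
    using has_integral_taylor_kernel[where d = ?d, OF ab \<open>n \<ge> 1\<close> d]
    by (intro taylor_kernel_bound_s_convex that assms) (auto simp: has_integral_iff)
  have "\<bar>(\<Sum>m=1..n. (-1) ^ (n - m + 2) * ((b - a) ^ m / (2 * fact m))
              * (?d (m - 1) b - (-1) ^ m * ?d (m - 1) a))
            + (-1) ^ n * integral {a..b} f\<bar> \<le> ?C"
  proof -
    have average: "\<bar>(u + v) / 2\<bar> \<le> C" if "\<bar>u\<bar> \<le> C" "\<bar>v\<bar> \<le> C" for u v C :: real
      using that by (auto simp: abs_le_iff)
    have "(\<Sum>m=1..n. (-1) ^ (n - m + 2) * ((b - a) ^ m / (2 * fact m))
              * (?d (m - 1) b - (-1) ^ m * ?d (m - 1) a))
            + (-1) ^ n * integral {a..b} f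
        = (integral {a..b} (\<lambda>x. (x - a) ^ n / fact n * ?d n x)
           + integral {a..b} (\<lambda>x. (x - b) ^ n / fact n * ?d n x)) / 2"
      using trapezoid_sum_eq_taylor_kernels[where d = ?d, OF ab \<open>n \<ge> 1\<close> d]
      by (simp only: nderiv.simps(1))
    then show ?thesis
      using average[OF bound[of a] bound[of b]] by (simp only: insertI1 insert_iff simp_thms)
  qed
  moreover have "Beta (real n * p + 1) 1 = 1 / (real n * p + 1)" if "q \<noteq> 1"
    using assms(10,11) that by (intro Beta_one_right add_nonneg_pos mult_nonneg_nonneg) auto
  ultimately show ?thesis by (cases "q = 1") simp_all
qed

end
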